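(* Let $X$ be a Banach space and let $T: X \to X$ be a (possibly nonlinear) operator that is Lipschitz with constant $k$, i.e. $\|T(x)-T(x')\| \le k\|x-x'\|$ for all $x,x'\in X$. Let $f\in X$. Then for every nonzero $\lambda\in\mathbb{R}$ with $|\lambda| k<1$, the equation $$\lambda T(x) + f = x$$ admits a solution $x\in X$.
   Context: Standing assumption: $\lambda$ is a nonzero real scalar. *)

theory Defs
  imports "HOL-Analysis.Analysis"
begin

end

theory Submission
  imports Defs
begin

text \<open>Solutions are the fixed points of \<open>\<lambda>x. lam *\<^sub>R T x + f\<close>.
  Translation by \<open>f\<close> preserves distances and scaling by \<open>lam\<close> multiplies
  them by \<open>\<bar>lam\<bar>\<close>, so this map is a contraction, and Banach's fixed-point
  theorem \<open>banach_fix_type\<close> applies in the complete space.\<close>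

theorem corollary1:
  fixes T :: "'a::banach \<Rightarrow> 'a" and f :: 'a and k lam :: real
  assumes "\<forall>x x'. norm (T x - T x') \<le> k * norm (x - x')"
    and "lam \<noteq> 0"
    and "\<bar>lam\<bar> * k < 1"
  shows "\<exists>x. lam *\<^sub>R T x + f = x"
proof -
  \<comment> \<open>\<^term>\<open>k\<close> can be negative when \<^typ>\<open>'a\<close> is the zero space, hence the maximum.\<close>
  define c where "c = max 0 (\<bar>lam\<bar> * k)"
  have "dist (lam *\<^sub>R T x + f) (lam *\<^sub>R T y + f) \<le> c * dist x y" for x y
  proof -
    have "dist (lam *\<^sub>R T x + f) (lam *\<^sub>R T y + f) = \<bar>lam\<bar> * norm (T x - T y)"
      by (simp add: dist_norm flip: scaleR_diff_right)
    also have "\<dots> \<le> \<bar>lam\<bar> * (k * norm (x - y))"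
      using assms(1) by (intro mult_left_mono) auto
    also have "\<dots> = (\<bar>lam\<bar> * k) * dist x y"
      by (simp add: dist_norm)
    also have "\<dots> \<le> c * dist x y"
      unfolding c_def by (intro mult_right_mono) auto
    finally show ?thesis .
  qed
  \<comment> \<open>The fixed-point theorem wants a factor in [0, 1): the maximum with 0 secures the
    lower bound and keeps the upper one.\<close>
  moreover have "0 \<le> c" "c < 1"
    using assms(3) by (auto simp: c_def)
  ultimately show ?thesis
    using banach_fix_type[of c "\<lambda>x. lam *\<^sub>R T x + f"] by blast
qed

end
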